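(* Let $n,m\ge 2$ be integers. If ($n=3t$ and $m=3r$) or ($n=3t$ and $m=3r+2$) for some nonnegative integers $t,r$, then $$b(P_n\boxtimes P_m)=1.$$
   Context: All graphs are finite, simple and undirected. $P_k$ denotes the path with $k$ vertices. The strong product $G\boxtimes H$ of graphs $G$ and $H$ has vertex set $V(G)\times V(H)$, and two vertices $(v,u)$ and $(v',u')$ are adjacent if and only if ($v=v'$ and $u\sim u'$), or ($v\sim v'$ and $u=u'$), or ($v\sim v'$ and $u\sim u'$), where $\sim$ denotes adjacency. A set $D$ of vertices of $G$ is dominating if every vertex of $G$ is in $D$ or adjacent to a vertex of $D$; the domination number $\gamma(G)$ is the minimum cardinality of a dominating set. For a graph $G$ with nonempty edge set $E$, the bondage number $b(G)$ is the minimum cardinality of a set $E'\subseteq E$ such that $\gamma(G-E')>\gamma(G)$, where $G-E'$ is obtained from $G$ by deleting the edges of $E'$ and keeping all vertices. *)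

theory Defs
  imports Main
begin

text \<open>An undirected graph is a vertex set with a set of edges, an edge being the
  two-element set of its endpoints.\<close>

record 'a ugraph =
  verts :: "'a set"
  edges :: "'a set set"

definition finite_simple_graph :: "'a ugraph \<Rightarrow> bool" where
  "finite_simple_graph G \<longleftrightarrow>
     finite (verts G) \<and> edges G \<subseteq> {e. e \<subseteq> verts G \<and> card e = 2}"

definition adjacent :: "'a ugraph \<Rightarrow> 'a \<Rightarrow> 'a \<Rightarrow> bool" where
  "adjacent G u v \<longleftrightarrow> {u, v} \<in> edges G"

definition path_graph :: "nat \<Rightarrow> nat ugraph" where
  "path_graph k = \<lparr>verts = {1..k}, edges = {{i, i + 1} |i. 1 \<le> i \<and> i + 1 \<le> k}\<rparr>"

definition strong_product :: "'a ugraph \<Rightarrow> 'b ugraph \<Rightarrow> ('a \<times> 'b) ugraph"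
    (infixl "\<boxtimes>" 70) where
  "G \<boxtimes> H =
    \<lparr>verts = verts G \<times> verts H,
     edges = {{(v, u), (v', u')} |v u v' u'.
       v \<in> verts G \<and> v' \<in> verts G \<and> u \<in> verts H \<and> u' \<in> verts H \<and>
       (v = v' \<and> adjacent H u u' \<or>
        adjacent G v v' \<and> u = u' \<or>
        adjacent G v v' \<and> adjacent H u u')}\<rparr>"

definition delete_edges :: "'a ugraph \<Rightarrow> 'a set set \<Rightarrow> 'a ugraph" where
  "delete_edges G F = \<lparr>verts = verts G, edges = edges G - F\<rparr>"

definition dominating :: "'a ugraph \<Rightarrow> 'a set \<Rightarrow> bool" where
  "dominating G D \<longleftrightarrow>
     D \<subseteq> verts G \<and> (\<forall>v\<in>verts G. v \<in> D \<or> (\<exists>w\<in>D. adjacent G v w))"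

definition domination_number :: "'a ugraph \<Rightarrow> nat" where
  "domination_number G = (LEAST k. \<exists>D. dominating G D \<and> card D = k)"

text \<open>The minimum below is over a nonempty set, hence meaningful, for every finite simple graph
  with at least one edge; see \<open>bondage_number_attained\<close>.\<close>

definition bondage_number :: "'a ugraph \<Rightarrow> nat" where
  "bondage_number G =
     (LEAST k. \<exists>F. F \<subseteq> edges G \<and> card F = k \<and>
        domination_number (delete_edges G F) > domination_number G)"

lemma finite_simple_path_graph: "finite_simple_graph (path_graph k)"
  by (auto simp: finite_simple_graph_def path_graph_def)

lemma edges_path_graph_nonempty: "k \<ge> 2 \<Longrightarrow> edges (path_graph k) \<noteq> {}"
  by (auto simp: path_graph_def intro!: exI[of _ 1])

lemma finite_simple_graph_irrefl:
  "finite_simple_graph G \<Longrightarrow> \<not> adjacent G v v"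
  by (auto simp: finite_simple_graph_def adjacent_def)

lemma adjacent_commute: "adjacent G u v \<longleftrightarrow> adjacent G v u"
  by (simp add: adjacent_def insert_commute)

lemma adjacent_in_verts:
  "finite_simple_graph G \<Longrightarrow> adjacent G u v \<Longrightarrow> u \<in> verts G \<and> v \<in> verts G"
  by (auto simp: finite_simple_graph_def adjacent_def)

lemma finite_simple_strong_product:
  assumes "finite_simple_graph G" "finite_simple_graph H"
  shows "finite_simple_graph (G \<boxtimes> H)"
proof -
  have "e \<subseteq> verts (G \<boxtimes> H) \<and> card e = 2" if "e \<in> edges (G \<boxtimes> H)" for e
  proof -
    from that obtain v u v' u' where e: "e = {(v, u), (v', u')}"
      and m: "v \<in> verts G" "v' \<in> verts G" "u \<in> verts H" "u' \<in> verts H"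
      and a: "adjacent H u u' \<or> adjacent G v v'"
      by (auto simp: strong_product_def)
    have "(v, u) \<noteq> (v', u')"
      using a finite_simple_graph_irrefl[OF assms(1)] finite_simple_graph_irrefl[OF assms(2)] by auto
    then show ?thesis using e m by (auto simp: strong_product_def)
  qed
  then have "edges (G \<boxtimes> H) \<subseteq> {e. e \<subseteq> verts (G \<boxtimes> H) \<and> card e = 2}"
    by blast
  moreover have "finite (verts (G \<boxtimes> H))"
    using assms by (simp add: finite_simple_graph_def strong_product_def)
  ultimately show ?thesis by (simp add: finite_simple_graph_def)
qed

lemma adjacent_strong_product:
  assumes "finite_simple_graph G" "finite_simple_graph H"
    and "v \<in> verts G" "v' \<in> verts G" "u \<in> verts H" "u' \<in> verts H"
  shows "adjacent (G \<boxtimes> H) (v, u) (v', u') \<longleftrightarrow>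
    v = v' \<and> adjacent H u u' \<or> adjacent G v v' \<and> u = u' \<or> adjacent G v v' \<and> adjacent H u u'"
proof
  assume "adjacent (G \<boxtimes> H) (v, u) (v', u')"
  then obtain a b a' b' where eq: "{(v, u), (v', u')} = {(a, b), (a', b')}"
    and d: "a = a' \<and> adjacent H b b' \<or> adjacent G a a' \<and> b = b' \<or>
      adjacent G a a' \<and> adjacent H b b'"
    unfolding adjacent_def[of "G \<boxtimes> H"] unfolding strong_product_def by auto
  from eq have "(v, u) = (a, b) \<and> (v', u') = (a', b') \<or> (v, u) = (a', b') \<and> (v', u') = (a, b)"
    by (simp only: doubleton_eq_iff)
  then show "v = v' \<and> adjacent H u u' \<or> adjacent G v v' \<and> u = u' \<or>
      adjacent G v v' \<and> adjacent H u u'"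
    using d adjacent_commute[of G] adjacent_commute[of H] by auto
next
  assume "v = v' \<and> adjacent H u u' \<or> adjacent G v v' \<and> u = u' \<or>
      adjacent G v v' \<and> adjacent H u u'"
  then show "adjacent (G \<boxtimes> H) (v, u) (v', u')"
    using assms(3-) unfolding adjacent_def[of "G \<boxtimes> H"] unfolding strong_product_def by auto
qed

lemma edges_strong_product_nonempty:
  assumes "finite_simple_graph G" "verts G \<noteq> {}" "finite_simple_graph H" "edges H \<noteq> {}"
  shows "edges (G \<boxtimes> H) \<noteq> {}"
proof -
  obtain e where e: "e \<in> edges H" using assms by auto
  then have "e \<subseteq> verts H" "card e = 2" using assms by (auto simp: finite_simple_graph_def)
  then obtain u u' where "e = {u, u'}" by (auto simp: card_2_iff)
  with e have a: "adjacent H u u'" by (simp add: adjacent_def)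
  obtain v where v: "v \<in> verts G" using assms by auto
  have "adjacent (G \<boxtimes> H) (v, u) (v, u')"
    using adjacent_strong_product[OF assms(1,3)] v a adjacent_in_verts[OF assms(3) a] by blast
  then show ?thesis by (auto simp: adjacent_def)
qed

lemma domination_number_attained:
  "\<exists>D. dominating G D \<and> card D = domination_number G"
  unfolding domination_number_def
  by (rule LeastI_ex) (auto simp: dominating_def)

lemma domination_number_le: "dominating G D \<Longrightarrow> domination_number G \<le> card D"
  unfolding domination_number_def by (rule Least_le) auto

lemma bondage_number_attained:
  assumes G: "finite_simple_graph G" and ne: "edges G \<noteq> {}"
  shows "\<exists>F. F \<subseteq> edges G \<and> card F = bondage_number G \<and>
    domination_number (delete_edges G F) > domination_number G"
proof -
  obtain e where e: "e \<in> edges G" using ne by auto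
  then have "e \<subseteq> verts G" "card e = 2" using G by (auto simp: finite_simple_graph_def)
  then obtain u v where uv: "e = {u, v}" "u \<noteq> v" "u \<in> verts G" "v \<in> verts G"
    by (auto simp: card_2_iff)
  have fin: "finite (verts G)" using G by (simp add: finite_simple_graph_def)
  have "dominating G (verts G - {u})"
    using e uv by (auto simp: dominating_def adjacent_def intro!: bexI[of _ v])
  then have "domination_number G \<le> card (verts G - {u})" by (rule domination_number_le)
  also have "\<dots> < card (verts G)" using fin uv by (intro card_Diff1_less)
  also have "\<dots> = domination_number (delete_edges G (edges G))"
  proof -
    obtain D where D: "dominating (delete_edges G (edges G)) D"
      "card D = domination_number (delete_edges G (edges G))"
      using domination_number_attained by blast
    then have "D = verts G" by (auto simp: dominating_def delete_edges_def adjacent_def)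
    with D show ?thesis by simp
  qed
  finally have "\<exists>k F. F \<subseteq> edges G \<and> card F = k \<and>
    domination_number (delete_edges G F) > domination_number G" by blast
  then show ?thesis unfolding bondage_number_def by (rule LeastI_ex)
qed

lemma bondage_number_le:
  assumes "F \<subseteq> edges G" "domination_number (delete_edges G F) > domination_number G"
  shows "bondage_number G \<le> card F"
  unfolding bondage_number_def using assms by (intro Least_le) auto

end

theory Submission
  imports Defs
begin

text \<open>In \<open>P\<^sub>n \<boxtimes> P\<^sub>m\<close> a vertex dominates the vertices that a chess king reaches
  from it, so at most a \<open>3 \<times> 3\<close> square. Cut the grid, starting at the corner \<open>(1,1)\<close>, into
  \<open>3 \<times> 3\<close> blocks. Under the hypotheses \<open>n\<close> is a multiple of \<open>3\<close> and \<open>m\<close> is not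
  \<open>1\<close> modulo \<open>3\<close>, so the only incomplete blocks have two columns, and every block still
  contains its centre, whose closed neighbourhood is exactly the block. Hence the centres dominate,
  and every dominating set meets every block: the domination number is the number of blocks, and a
  minimum dominating set has exactly one vertex in each block (\<open>inj_on_block\<close>).

  The edge to delete joins \<open>(2,1)\<close> and \<open>(2,2)\<close>. Let a dominating set of the remaining graph
  have only as many vertices as there are blocks. Since it dominates the corner, its only
  vertex in the first block lies in the first two rows and columns. Because \<open>n\<close> is divisible by \<open>3\<close>, the
  vertices of the first strip of blocks have no slack in the first coordinate, and the vertex cannot
  be in row \<open>1\<close> (\<open>strip_row_ge\<close>). So it is \<open>(2,1)\<close> or \<open>(2,2)\<close>; but all neighbours
  of these two vertices lie in the first block, and after the deletion neither dominates the
  other. The domination number has therefore increased.\<close>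

section \<open>Domination in the king's graph\<close>

lemma finite_simple_king_graph: "finite_simple_graph (path_graph n \<boxtimes> path_graph m)"
  by (intro finite_simple_strong_product finite_simple_path_graph)

lemma verts_path_graph: "verts (path_graph k) = {1..k}"
  by (simp add: path_graph_def)

lemma verts_king_graph: "verts (path_graph n \<boxtimes> path_graph m) = {1..n} \<times> {1..m}"
  by (simp add: strong_product_def verts_path_graph)

lemma adjacent_path_graph:
  "adjacent (path_graph k) u v \<longleftrightarrow> u \<in> {1..k} \<and> v \<in> {1..k} \<and> (v = u + 1 \<or> u = v + 1)"
  by (auto simp: adjacent_def path_graph_def doubleton_eq_iff)

lemma adjacent_king_graph:
  assumes "(x, y) \<in> {1..n} \<times> {1..m}" "(x', y') \<in> {1..n} \<times> {1..m}"
  shows "adjacent (path_graph n \<boxtimes> path_graph m) (x, y) (x', y') \<longleftrightarrow>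
    (x, y) \<noteq> (x', y') \<and> x \<le> x' + 1 \<and> x' \<le> x + 1 \<and> y \<le> y' + 1 \<and> y' \<le> y + 1"
  using assms
  by (subst adjacent_strong_product[OF finite_simple_path_graph finite_simple_path_graph])
    (auto simp: adjacent_path_graph verts_path_graph)

lemma dominating_king_graphE:
  assumes "dominating (path_graph n \<boxtimes> path_graph m) D" "(x, y) \<in> {1..n} \<times> {1..m}"
  obtains x' y' where "(x', y') \<in> D" "(x', y') \<in> {1..n} \<times> {1..m}"
    "x \<le> x' + 1" "x' \<le> x + 1" "y \<le> y' + 1" "y' \<le> y + 1"
proof -
  have sub: "D \<subseteq> {1..n} \<times> {1..m}"
    using assms(1) by (simp add: dominating_def verts_king_graph)
  from assms consider "(x, y) \<in> D"
    | w where "w \<in> D" "adjacent (path_graph n \<boxtimes> path_graph m) (x, y) w"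
    unfolding dominating_def verts_king_graph by blast
  then show thesis
  proof cases
    case 1
    then show thesis using assms(2) by (intro that[of x y]) auto
  next
    case 2
    obtain x' y' where w: "w = (x', y')" by (cases w)
    with 2 sub have "(x', y') \<in> {1..n} \<times> {1..m}" by blast
    with adjacent_king_graph[OF assms(2) this] 2 w show thesis by (intro that[of x' y']) auto
  qed
qed

lemma dominating_delete_edgesD: "dominating (delete_edges G F) D \<Longrightarrow> dominating G D"
  by (auto simp: dominating_def delete_edges_def adjacent_def)

section \<open>Blocks\<close>

text \<open>Blocks are numbered from \<open>1\<close>, so block \<open>(i, j)\<close> has centre \<open>(3 * i - 1, 3 * j - 1)\<close>.\<close>

definition block :: "nat \<times> nat \<Rightarrow> nat \<times> nat" where
  "block v = ((fst v + 2) div 3, (snd v + 2) div 3)"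

lemma block_Pair: "block (x, y) = ((x + 2) div 3, (y + 2) div 3)"
  by (simp add: block_def)

definition block_indices :: "nat \<Rightarrow> nat \<Rightarrow> (nat \<times> nat) set" where
  "block_indices n m = {1..(n + 2) div 3} \<times> {1..(m + 2) div 3}"

text \<open>A last row or column of blocks of width \<open>1\<close> would have its centres outside the grid;
  the congruence condition excludes this.\<close>

lemma block_centre_in_range:
  fixes i k :: nat
  assumes "i \<in> {1..(k + 2) div 3}" "k mod 3 \<noteq> 1"
  shows "3 * i - 1 \<in> {1..k}"
proof -
  have "1 \<le> i" "3 * i \<le> k + 2" using assms(1) by auto
  moreover have "3 * i \<noteq> k + 2" using assms(2) by presburger
  ultimately have "1 \<le> 3 * i - 1 \<and> 3 * i - 1 \<le> k" by linarith
  then show ?thesis by simp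
qed

lemma domination_number_king_le:
  assumes "n mod 3 \<noteq> 1" "m mod 3 \<noteq> 1"
  shows "domination_number (path_graph n \<boxtimes> path_graph m) \<le> card (block_indices n m)"
proof -
  let ?c = "\<lambda>(i, j). (3 * i - 1, 3 * j - 1) :: nat \<times> nat"
  let ?C = "?c ` block_indices n m"
  have sub: "?C \<subseteq> {1..n} \<times> {1..m}"
    unfolding block_indices_def
    by (auto simp only: mem_Sigma_iff prod.case intro!: block_centre_in_range assms)
  have "v \<in> ?C \<or> (\<exists>w\<in>?C. adjacent (path_graph n \<boxtimes> path_graph m) v w)"
    if v: "v \<in> {1..n} \<times> {1..m}" for v
  proof -
    obtain x y where xy: "v = (x, y)" by (cases v)
    have "block v \<in> block_indices n m"
      using v xy by (auto simp: block_Pair block_indices_def intro: div_le_mono)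
    then have c: "?c (block v) \<in> ?C" by blast
    have near: "3 * ((k + 2) div 3) - 1 \<le> k + 1" "k \<le> 3 * ((k + 2) div 3) - 1 + 1" for k :: nat
      by presburger+
    obtain a b where ab: "?c (block v) = (a, b)" by (cases "?c (block v)")
    then have "x \<le> a + 1" "a \<le> x + 1" "y \<le> b + 1" "b \<le> y + 1"
      using near[of x] near[of y] xy by (auto simp: block_Pair)
    moreover have ab_in: "(a, b) \<in> ?C" using c ab by metis
    ultimately have "v = (a, b) \<or> adjacent (path_graph n \<boxtimes> path_graph m) v (a, b)"
      using adjacent_king_graph[of x y n m a b] sub v xy by blast
    with ab_in show ?thesis by metis
  qed
  then have "dominating (path_graph n \<boxtimes> path_graph m) ?C"
    using sub by (simp add: dominating_def verts_king_graph)
  then have "domination_number (path_graph n \<boxtimes> path_graph m) \<le> card ?C"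
    by (rule domination_number_le)
  also have "\<dots> \<le> card (block_indices n m)"
    by (rule card_image_le) (simp add: block_indices_def)
  finally show ?thesis .
qed

text \<open>Whatever dominates the centre of a block lies in that block, so a dominating set meets
  all blocks; if it has no more vertices than there are blocks, it cannot meet one twice.\<close>

lemma inj_on_block:
  assumes D: "dominating (path_graph n \<boxtimes> path_graph m) D"
    and mods: "n mod 3 \<noteq> 1" "m mod 3 \<noteq> 1"
    and card: "card D \<le> card (block_indices n m)"
  shows "inj_on block D"
proof -
  have "p \<in> block ` D" if p: "p \<in> block_indices n m" for p
  proof -
    obtain i j where ij: "p = (i, j)" by (cases p)
    have ge: "i \<ge> 1" "j \<ge> 1" using p ij by (auto simp: block_indices_def)
    have "(3 * i - 1, 3 * j - 1) \<in> {1..n} \<times> {1..m}"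
      using p ij block_centre_in_range mods unfolding block_indices_def by blast
    then obtain x y where xy: "(x, y) \<in> D" "3 * i - 1 \<le> x + 1" "x \<le> 3 * i - 1 + 1"
      "3 * j - 1 \<le> y + 1" "y \<le> 3 * j - 1 + 1"
      by (rule dominating_king_graphE[OF D])
    have "(x + 2) div 3 = i" using xy(2,3) ge(1) by presburger
    moreover have "(y + 2) div 3 = j" using xy(4,5) ge(2) by presburger
    ultimately have "block (x, y) = p" by (simp add: block_Pair ij)
    with xy(1) show ?thesis by blast
  qed
  then have hit: "block_indices n m \<subseteq> block ` D" by blast
  have fin: "finite D"
    using D finite_subset[of D "{1..n} \<times> {1..m}"] by (simp add: dominating_def verts_king_graph)
  have "card D \<le> card (block ` D)"
    using card card_mono[OF _ hit] fin by (simp add: order_trans)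
  then have "card (block ` D) = card D" using card_image_le[OF fin, of block] by linarith
  with fin show ?thesis by (rule eq_card_imp_inj_on)
qed

text \<open>The strip consists of the blocks \<open>(i, 1)\<close>, and its last row ends a complete block.
  No row follows it, so the only vertex of \<open>D\<close> in the last block has to dominate it and
  is not in that block's first row. Hence it cannot help to dominate the last row of the
  block before, and the argument repeats down to the first block.\<close>

lemma strip_row_ge:
  assumes D: "dominating (path_graph (3 * t) \<boxtimes> path_graph m) D"
    and inj: "inj_on block D" and m: "m \<ge> 2"
    and i: "1 \<le> i" "i \<le> t"
    and xy: "(x, y) \<in> D" "block (x, y) = (i, 1)"
  shows "3 * i - 1 \<le> x"
  using i xy
proof (induction "t - i" arbitrary: i x y rule: less_induct)
  case less
  have "(3 * i, 2) \<in> {1..3 * t} \<times> {1..m}" using less.prems m by simp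
  then obtain x' y' where d: "(x', y') \<in> D" "(x', y') \<in> {1..3 * t} \<times> {1..m}"
    "3 * i \<le> x' + 1" "x' \<le> 3 * i + 1" "2 \<le> y' + 1" "y' \<le> 2 + 1"
    by (rule dominating_king_graphE[OF D])
  have y': "(y' + 2) div 3 = 1" using d(5,6) by presburger
  show ?case
  proof (cases "x' \<le> 3 * i")
    case True
    have "(x' + 2) div 3 = i" using True d(3) by presburger
    then have "block (x', y') = block (x, y)" using y' less.prems by (simp add: block_Pair)
    then have "(x', y') = (x, y)" using inj d(1) less.prems(3) by (blast dest: inj_onD)
    then show ?thesis using d(3) by simp
  next
    case False
    then have x': "x' = 3 * i + 1" using d(4) by simp
    then have next_block: "i + 1 \<le> t" "block (x', y') = (i + 1, 1)"
      using d(2) y' by (auto simp: block_Pair)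
    have "t - (i + 1) < t - i" using next_block(1) by simp
    from less.hyps[OF this _ next_block(1) d(1) next_block(2)] x' show ?thesis by simp
  qed
qed

section \<open>Deleting the edge\<close>

text \<open>One end of the deleted edge is the only vertex of a small dominating set in the first
  block. Every neighbour of the other end is in that block, so the other end depended on
  exactly the edge that is gone.\<close>

lemma domination_number_delete_edge_king:
  assumes t: "t \<ge> 1" and m: "m \<ge> 2" "m mod 3 \<noteq> 1"
  shows "card (block_indices (3 * t) m) <
    domination_number (delete_edges (path_graph (3 * t) \<boxtimes> path_graph m) {{(2, 1), (2, 2)}})"
    (is "?b < domination_number ?G'")
proof (rule ccontr)
  let ?G = "path_graph (3 * t) \<boxtimes> path_graph m"
  assume "\<not> ?b < domination_number ?G'"
  then obtain D where D': "dominating ?G' D" and card: "card D \<le> ?b"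
    using domination_number_attained[of ?G'] by fastforce
  have D: "dominating ?G D" using D' by (rule dominating_delete_edgesD)
  have inj: "inj_on block D" using inj_on_block[OF D _ m(2) card] by simp
  have "(1, 1) \<in> {1..3 * t} \<times> {1..m}" using t m by simp
  then obtain x y where xy: "(x, y) \<in> D" "(x, y) \<in> {1..3 * t} \<times> {1..m}" "x \<le> 2" "y \<le> 2"
    by (rule dominating_king_graphE[OF D]) auto
  have bxy: "block (x, y) = (1, 1)"
  proof -
    have "x \<in> {1, 2}" "y \<in> {1, 2}" using xy(2-4) by auto
    then show ?thesis by (auto simp: block_Pair)
  qed
  have "3 * 1 - 1 \<le> x" by (rule strip_row_ge[OF D inj m(1) _ t xy(1) bxy]) simp
  with xy have x: "x = 2" by simp
  have y: "y = 1 \<or> y = 2" using xy(2,4) by auto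
  \<comment> \<open>The other end of the deleted edge; the first block contains its closed neighbourhood.\<close>
  define z where "z = 3 - y"
  have z: "z = 1 \<and> y = 2 \<or> z = 2 \<and> y = 1" using y by (auto simp: z_def)
  have e: "{(2, z), (x, y)} = {(2, 1), (2, 2)}" using z x by auto
  have vz: "(2, z) \<in> {1..3 * t} \<times> {1..m}" using z t m by auto
  have unique: "(x', y') = (x, y)"
    if w: "(x', y') \<in> D" "x' \<in> {1..3}" "y' \<in> {1..3}" for x' y'
  proof -
    have "(x' + 2) div 3 = 1" "(y' + 2) div 3 = 1" using w(2,3) by auto
    then have "block (x', y') = block (x, y)" using bxy by (simp add: block_Pair)
    then show ?thesis using inj w(1) xy(1) by (blast dest: inj_onD)
  qed
  have "(2, z) \<notin> D" using unique[of 2 z] z by auto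
  then obtain w where w: "w \<in> D" "adjacent ?G' (2, z) w"
    using D' vz verts_king_graph[of "3 * t" m]
    by (metis dominating_def delete_edges_def ugraph.select_convs(1))
  obtain x' y' where w': "w = (x', y')" by (cases w)
  have adj: "adjacent ?G (2, z) (x', y')" and ne: "{(2, z), w} \<noteq> {(2, 1), (2, 2)}"
    using w w' by (auto simp: adjacent_def delete_edges_def)
  have vw: "(x', y') \<in> {1..3 * t} \<times> {1..m}"
    using D w w' verts_king_graph[of "3 * t" m] by (auto simp: dominating_def)
  have "x' \<in> {1..3}" "y' \<in> {1..3}"
    using adj adjacent_king_graph[OF vz vw] vw z by auto
  then have "w = (x, y)" using unique w(1) w' by blast
  with ne e show False by simp
qed

lemma bondage_number_eq_1I:
  assumes G: "finite_simple_graph G" and e: "e \<in> edges G"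
    and less: "domination_number G < domination_number (delete_edges G {e})"
  shows "bondage_number G = 1"
proof -
  have "bondage_number G \<le> 1" using bondage_number_le[of "{e}" G] e less by simp
  moreover have "bondage_number G \<noteq> 0"
  proof
    assume "bondage_number G = 0"
    then obtain F where F: "F \<subseteq> edges G" "card F = 0"
      "domination_number (delete_edges G F) > domination_number G"
      using bondage_number_attained[OF G] e by auto
    have "edges G \<subseteq> Pow (verts G)" "finite (verts G)"
      using G by (auto simp: finite_simple_graph_def)
    then have "finite F" using F(1) by (meson finite_Pow_iff finite_subset)
    with F have "delete_edges G F = G" by (simp add: delete_edges_def)
    with F(3) show False by simp
  qed
  ultimately show ?thesis by simp
qed

theorem theorem5:
  fixes n m :: nat
  assumes "n \<ge> 2" and "m \<ge> 2"
    and "\<exists>t r :: nat. (n = 3 * t \<and> m = 3 * r) \<or> (n = 3 * t \<and> m = 3 * r + 2)"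
  shows "bondage_number (path_graph n \<boxtimes> path_graph m) = 1"
proof -
  from assms(3) obtain t r where n: "n = 3 * t" and "m = 3 * r \<or> m = 3 * r + 2" by blast
  then have mod: "m mod 3 \<noteq> 1" by presburger
  have t: "t \<ge> 1" using assms(1) n by simp
  have "adjacent (path_graph n \<boxtimes> path_graph m) (2, 1) (2, 2)"
    using adjacent_king_graph[of 2 1 n m 2 2] assms(1,2) by simp
  then have "{(2, 1), (2, 2)} \<in> edges (path_graph n \<boxtimes> path_graph m)"
    by (simp add: adjacent_def)
  moreover have "domination_number (path_graph n \<boxtimes> path_graph m)
      < domination_number (delete_edges (path_graph n \<boxtimes> path_graph m) {{(2, 1), (2, 2)}})"
    using domination_number_king_le[of n m] domination_number_delete_edge_king[OF t assms(2) mod]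
      mod n by (simp add: order.strict_trans1)
  ultimately show ?thesis by (rule bondage_number_eq_1I[OF finite_simple_king_graph])
qed

end
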